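(* Let $(\Sigma, A, R)$ be a stream GSOS specification and let $(\tilde\Sigma, A, \tilde R)$ be the corresponding monadic specification constructed below. Then for every closed term $t \in T_\Sigma\emptyset$, we have $t \sim \tilde t$; that is, the stream generated by $t$ in the stream system on closed terms induced by $(\Sigma,A,R)$ equals the stream generated by $\tilde t$ in the stream system on closed terms induced by $(\tilde\Sigma,A,\tilde R)$.
   Context: A stream system with outputs in a set $A$ is a map $X\to A\times X$, $x\mapsto (o(x),d(x))$; write $x\xrightarrow{a}y$ if $o(x)=a$ and $d(x)=y$. Two states are bisimilar ($\sim$) iff they generate the same stream $o(x)\,o(d(x))\,o(d(d(x)))\cdots$. A signature $\Sigma$ is a set of operation symbols with finite arities; $T_\Sigma X$ denotes $\Sigma$-terms over $X$ and $T_\Sigma\emptyset$ the closed terms. A stream GSOS rule for $\Sigma$ and $A$ has the form $$\frac{x_1\xrightarrow{a_1}x_1'\ \cdots\ x_n\xrightarrow{a_n}x_n'}{f(x_1,\dots,x_n)\xrightarrow{a} t}$$ with $f\in\Sigma$ of arity $n$, $x_1,\dots,x_n,x_1',\dots,x_n'$ pairwise distinct variables, $t$ a $\Sigma$-term over $\{x_1,\dots,x_n,x_1',\dots,x_n'\}$, and $a,a_1,\dots,a_n\in A$; the rule is triggered by $(a_1,\dots,a_n)$. A stream GSOS specification $(\Sigma,A,R)$ is a set $R$ of such rules such that for each $f$ of arity $n$ and each $(a_1,\dots,a_n)\in A^n$ exactly one rule for $f$ is triggered by it. It induces a stream system on closed terms inductively: $f(t_1,\dots,t_n)\xrightarrow{a}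 t[t_i/x_i, t_i'/x_i']$ whenever $t_i\xrightarrow{a_i}t_i'$ for all $i$ and the rule for $f$ triggered by $(a_1,\dots,a_n)$ has conclusion $f(x_1,\dots,x_n)\xrightarrow{a}t$. The monadic translation $(\tilde\Sigma,A,\tilde R)$: $\tilde\Sigma=\{\tilde f\mid f\in\Sigma\}\cup\{a.\_\mid a\in A\}$ ($\tilde f$ has the arity of $f$, each $a.\_$ is unary). $\tilde R$ contains, for all $a,b\in A$, the prefix rule $\frac{x\xrightarrow{b}x'}{a.x\xrightarrow{a}b.x'}$, and for each rule of $R$ as displayed above, the rule $$\frac{x_1\xrightarrow{a_1}x_1'\ \cdots\ x_n\xrightarrow{a_n}x_n'}{\tilde f(x_1,\dots,x_n)\xrightarrow{a}\tilde t(a_1.x_1',\dots,a_n.x_n',x_1',\dots,x_n')}$$ where $\tilde t$ is obtained from $t$ by replacing each $g\in\Sigma$ by $\tilde g$, and $\tilde t(a_1.x_1',\dots,a_n.x_n',x_1',\dots,x_n')$ denotes substituting $a_i.x_i'$ for $x_i$. For a closed term $t\in T_\Sigma\emptyset$, $\tilde t\in T_{\tilde\Sigma}\emptyset$ is obtained by replacing each $g\in\Sigma$ by $\tilde g$. *)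

theory Defs
  imports "HOL-Library.Stream"
begin

datatype ('f, 'v) trm = Var 'v | App 'f "('f, 'v) trm list"

inductive_set terms :: "'f set \<Rightarrow> ('f \<Rightarrow> nat) \<Rightarrow> 'v set \<Rightarrow> ('f, 'v) trm set"
  for F :: "'f set" and ar :: "'f \<Rightarrow> nat" and V :: "'v set" where
  Var: "v \<in> V \<Longrightarrow> Var v \<in> terms F ar V"
| App: "f \<in> F \<Longrightarrow> length ts = ar f \<Longrightarrow> (\<forall>s\<in>set ts. s \<in> terms F ar V)
    \<Longrightarrow> App f ts \<in> terms F ar V"

primrec subst :: "('v \<Rightarrow> ('f, 'w) trm) \<Rightarrow> ('f, 'v) trm \<Rightarrow> ('f, 'w) trm" where
  "subst \<sigma> (Var v) = \<sigma> v"
| "subst \<sigma> (App f ts) = App f (map (subst \<sigma>) ts)"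

text \<open>
  Rules are taken with canonically named variables: the source \<open>x_i\<close> of the \<open>i\<close>-th premise is
  \<open>Src i\<close> and its target \<open>x_i'\<close> is \<open>Tgt i\<close>, counting from 0. Hence pairwise distinctness is built
  in, renamed variants of a rule are not separate rules, and a rule is determined by its
  operation symbol, the list of premise labels that triggers it, and the output and target
  term of its conclusion.
\<close>

datatype rvar = Src nat | Tgt nat

datatype ('f, 'a) rule =
  Rule (rule_op: 'f) (trigger: "'a list") (rule_out: 'a) (rule_target: "('f, rvar) trm")

record ('f, 'a) spec =
  Sig :: "'f set"
  arity :: "'f \<Rightarrow> nat"
  Out :: "'a set"
  Rules :: "('f, 'a) rule set"

definition rule_vars :: "nat \<Rightarrow> rvar set" where
  "rule_vars n = Src ` {..<n} \<union> Tgt ` {..<n}"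

definition wf_rule :: "('f, 'a) spec \<Rightarrow> ('f, 'a) rule \<Rightarrow> bool" where
  "wf_rule S r \<longleftrightarrow>
     rule_op r \<in> Sig S \<and>
     length (trigger r) = arity S (rule_op r) \<and> set (trigger r) \<subseteq> Out S \<and>
     rule_out r \<in> Out S \<and>
     rule_target r \<in> terms (Sig S) (arity S) (rule_vars (arity S (rule_op r)))"

definition stream_gsos :: "('f, 'a) spec \<Rightarrow> bool" where
  "stream_gsos S \<longleftrightarrow>
     (\<forall>r\<in>Rules S. wf_rule S r) \<and>
     (\<forall>f\<in>Sig S. \<forall>as. length as = arity S f \<and> set as \<subseteq> Out S \<longrightarrow>
        (\<exists>!r. r \<in> Rules S \<and> rule_op r = f \<and> trigger r = as))"

abbreviation closed_terms :: "('f, 'a) spec \<Rightarrow> ('f, 'v) trm set" where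
  "closed_terms S \<equiv> terms (Sig S) (arity S) {}"

fun inst :: "('f, 'v) trm list \<Rightarrow> ('f, 'v) trm list \<Rightarrow> rvar \<Rightarrow> ('f, 'v) trm" where
  "inst ts ts' (Src i) = ts ! i"
| "inst ts ts' (Tgt i) = ts' ! i"

inductive step :: "('f, 'a) spec \<Rightarrow> ('f, 'v) trm \<Rightarrow> 'a \<Rightarrow> ('f, 'v) trm \<Rightarrow> bool"
  for S :: "('f, 'a) spec" where
  "Rule f as a t \<in> Rules S \<Longrightarrow> length ts = length as \<Longrightarrow> length ts' = length as \<Longrightarrow>
   (\<forall>i<length as. step S (ts ! i) (as ! i) (ts' ! i)) \<Longrightarrow>
   step S (App f ts) a (subst (inst ts ts') t)"

text \<open>
  The induced stream system; meaningful on closed terms only, where the transition is unique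
  (lemma \<open>step_unique\<close> below).
\<close>

definition term_system :: "('f, 'a) spec \<Rightarrow> ('f, 'v) trm \<Rightarrow> 'a \<times> ('f, 'v) trm" where
  "term_system S t = (THE p. step S t (fst p) (snd p))"

definition generated_stream :: "('x \<Rightarrow> 'a \<times> 'x) \<Rightarrow> 'x \<Rightarrow> 'a stream" where
  "generated_stream c x = smap (\<lambda>y. fst (c y)) (siterate (\<lambda>y. snd (c y)) x)"

definition bisimilar :: "('x \<Rightarrow> 'a \<times> 'x) \<Rightarrow> ('y \<Rightarrow> 'a \<times> 'y) \<Rightarrow> 'x \<Rightarrow> 'y \<Rightarrow> bool" where
  "bisimilar c d x y \<longleftrightarrow> generated_stream c x = generated_stream d y"

datatype ('f, 'a) mop = Tilde 'f | Prefix 'a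

fun mop_arity :: "('f \<Rightarrow> nat) \<Rightarrow> ('f, 'a) mop \<Rightarrow> nat" where
  "mop_arity ar (Tilde f) = ar f"
| "mop_arity ar (Prefix a) = 1"

definition tilde :: "('f, 'v) trm \<Rightarrow> (('f, 'a) mop, 'v) trm" where
  "tilde t = map_trm Tilde (\<lambda>v. v) t"

definition prefix_rule :: "'a \<Rightarrow> 'a \<Rightarrow> (('f, 'a) mop, 'a) rule" where
  "prefix_rule a b = Rule (Prefix a) [b] a (App (Prefix b) [Var (Tgt 0)])"

fun prefix_sources :: "'a list \<Rightarrow> rvar \<Rightarrow> (('f, 'a) mop, rvar) trm" where
  "prefix_sources as (Src i) = App (Prefix (as ! i)) [Var (Tgt i)]"
| "prefix_sources as (Tgt i) = Var (Tgt i)"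

fun tilde_rule :: "('f, 'a) rule \<Rightarrow> (('f, 'a) mop, 'a) rule" where
  "tilde_rule (Rule f as a t) = Rule (Tilde f) as a (subst (prefix_sources as) (tilde t))"

definition monadic :: "('f, 'a) spec \<Rightarrow> (('f, 'a) mop, 'a) spec" where
  "monadic S = \<lparr>
     Sig = Tilde ` Sig S \<union> Prefix ` Out S,
     arity = mop_arity (arity S),
     Out = Out S,
     Rules = {prefix_rule a b | a b. a \<in> Out S \<and> b \<in> Out S} \<union> tilde_rule ` Rules S \<rparr>"

lemma subst_terms:
  assumes "t \<in> terms F ar V" and "\<And>v. v \<in> V \<Longrightarrow> \<sigma> v \<in> terms F ar W"
  shows "subst \<sigma> t \<in> terms F ar W"
  using assms(1) by induction (auto intro!: terms.App assms(2))

lemma step_unique: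
  assumes S: "stream_gsos S" and t: "t \<in> closed_terms S"
  shows "\<exists>!p. step S t (fst p) (snd p)"
    and "fst (term_system S t) \<in> Out S" and "snd (term_system S t) \<in> closed_terms S"
proof -
  have "\<exists>a t'. a \<in> Out S \<and> t' \<in> closed_terms S \<and> step S t a t' \<and>
      (\<forall>b u. step S t b u \<longrightarrow> b = a \<and> u = t')"
    using t
  proof induction
    case (App f ts)
    then obtain g h where gh: "\<And>s. s \<in> set ts \<Longrightarrow> g s \<in> Out S \<and> h s \<in> closed_terms S \<and>
        step S s (g s) (h s) \<and> (\<forall>b u. step S s b u \<longrightarrow> b = g s \<and> u = h s)"
      by metis
    define as where "as = map g ts"
    have as: "length as = arity S f" "set as \<subseteq> Out S"
      using App(2) gh by (auto simp: as_def)
    then obtain r where r: "r \<in> Rules S" "rule_op r = f" "trigger r = as"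
      and uniq: "\<And>r'. r' \<in> Rules S \<Longrightarrow> rule_op r' = f \<Longrightarrow> trigger r' = as \<Longrightarrow> r' = r"
      using S App(1) unfolding stream_gsos_def by metis
    obtain a t0 where rr: "r = Rule f as a t0" using r by (cases r) auto
    have wf: "a \<in> Out S" "t0 \<in> terms (Sig S) (arity S) (rule_vars (arity S f))"
      using S r(1) rr by (auto simp: stream_gsos_def wf_rule_def)
    let ?t = "subst (inst ts (map h ts)) t0"
    have "step S (App f ts) a ?t"
      using r(1) rr gh by (intro step.intros[of f as]) (auto simp: as_def)
    moreover have "?t \<in> closed_terms S"
      using wf(2) by (rule subst_terms) (use App gh in \<open>auto simp: rule_vars_def\<close>)
    moreover have "b = a \<and> u = ?t" if "step S (App f ts) b u" for b u
      using that
    proof cases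
      case (1 as' t' ts')
      have "as' = as" "ts' = map h ts"
        using 1 gh by (auto simp: as_def intro!: nth_equalityI)
      then show ?thesis using uniq[OF 1(2)] rr 1 by auto
    qed
    ultimately show ?case using wf(1) by blast
  qed auto
  then obtain a t' where *: "a \<in> Out S" "t' \<in> closed_terms S" "step S t a t'"
      "\<And>b u. step S t b u \<Longrightarrow> b = a \<and> u = t'" by blast
  have eq: "step S t (fst p) (snd p) \<longleftrightarrow> p = (a, t')" for p
    using *(3) *(4)[of "fst p" "snd p"] by (cases p) auto
  show "\<exists>!p. step S t (fst p) (snd p)"
    by (simp add: eq)
  have "term_system S t = (a, t')"
    by (simp add: term_system_def eq)
  then show "fst (term_system S t) \<in> Out S" and "snd (term_system S t) \<in> closed_terms S"
    using *(1,2) by simp_all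
qed

lemma tilde_terms:
  assumes "t \<in> terms (Sig S) (arity S) V"
  shows "tilde t \<in> terms (Sig (monadic S)) (arity (monadic S)) V"
  using assms unfolding tilde_def
  by induction (auto simp: monadic_def intro!: terms.intros)

lemma stream_gsos_monadic:
  assumes S: "stream_gsos S"
  shows "stream_gsos (monadic S)"
proof -
  have "wf_rule (monadic S) r" if "r \<in> Rules (monadic S)" for r
  proof (cases "\<exists>a b. a \<in> Out S \<and> b \<in> Out S \<and> r = prefix_rule a b")
    case True
    then show ?thesis
      by (auto simp: wf_rule_def prefix_rule_def monadic_def rule_vars_def intro!: terms.intros)
  next
    case False
    then have "r \<in> tilde_rule ` Rules S"
      using that by (auto simp: monadic_def)
    then obtain r' where "r' \<in> Rules S" "r = tilde_rule r'"
      by blast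
    then obtain f as a t where q: "Rule f as a t \<in> Rules S" "r = tilde_rule (Rule f as a t)"
      by (cases r') simp
    have "wf_rule S (Rule f as a t)"
      using S q(1) by (simp add: stream_gsos_def)
    then have wf: "f \<in> Sig S" "length as = arity S f" "set as \<subseteq> Out S" "a \<in> Out S"
        "t \<in> terms (Sig S) (arity S) (rule_vars (arity S f))"
      by (simp_all add: wf_rule_def)
    have "subst (prefix_sources as) (tilde t)
        \<in> terms (Sig (monadic S)) (arity (monadic S)) (rule_vars (arity S f))"
      using tilde_terms[OF wf(5)]
      by (rule subst_terms)
        (use wf(2,3) in \<open>auto simp: rule_vars_def monadic_def subset_iff intro!: terms.intros\<close>)
    then show ?thesis using wf q(2) by (auto simp: wf_rule_def monadic_def)
  qed
  moreover have "\<exists>!r. r \<in> Rules (monadic S) \<and> rule_op r = f \<and> trigger r = as"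
    if f: "f \<in> Sig (monadic S)" and as: "length as = arity (monadic S) f" "set as \<subseteq> Out (monadic S)"
    for f as
  proof (cases f)
    case (Tilde g)
    then have "g \<in> Sig S" "length as = arity S g" "set as \<subseteq> Out S"
      using f as by (auto simp: monadic_def)
    then obtain r where r: "r \<in> Rules S" "rule_op r = g" "trigger r = as"
      and uniq: "\<And>r'. r' \<in> Rules S \<Longrightarrow> rule_op r' = g \<Longrightarrow> trigger r' = as \<Longrightarrow> r' = r"
      using S unfolding stream_gsos_def by metis
    have sel: "rule_op (tilde_rule q) = Tilde (rule_op q)" "trigger (tilde_rule q) = trigger q"
      for q :: "('a, 'b) rule" by (cases q; simp)+
    show ?thesis
    proof (rule ex1I[of _ "tilde_rule r"])
      show "tilde_rule r \<in> Rules (monadic S) \<and> rule_op (tilde_rule r) = f \<and> trigger (tilde_rule r) = as"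
        using r Tilde by (auto simp: sel monadic_def)
    next
      fix q assume "q \<in> Rules (monadic S) \<and> rule_op q = f \<and> trigger q = as"
      then show "q = tilde_rule r"
        using uniq Tilde by (auto simp: sel monadic_def prefix_rule_def)
    qed
  next
    case (Prefix a)
    then have a: "a \<in> Out S" using f by (auto simp: monadic_def)
    obtain b where b: "as = [b]" "b \<in> Out S"
      using as Prefix by (cases as) (auto simp: monadic_def)
    have sel: "rule_op (tilde_rule q) = Tilde (rule_op q)" for q :: "('a, 'b) rule"
      by (cases q) simp
    have "q = prefix_rule a b"
      if "q \<in> Rules (monadic S)" "rule_op q = f" "trigger q = as" for q
      using that Prefix b by (auto simp: sel monadic_def prefix_rule_def)
    moreover have "prefix_rule a b \<in> Rules (monadic S)"
      "rule_op (prefix_rule a b) = f" "trigger (prefix_rule a b) = as"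
      using a b Prefix by (auto simp: monadic_def prefix_rule_def)
    ultimately show ?thesis by blast
  qed
  ultimately show ?thesis by (auto simp: stream_gsos_def)
qed

end

theory Submission
  imports Defs
begin

text \<open>
  The source \<open>x\<^sub>i\<close> of a premise is replaced by \<open>a\<^sub>i.x\<^sub>i'\<close> in the monadic rule, so derivatives of
  \<open>tilde t\<close> are no longer of the form \<open>tilde t'\<close>. The relation \<open>mrel\<close> therefore also lets a state
  \<open>s\<close> be represented by \<open>a.u'\<close> whenever \<open>s\<close> steps with output \<open>a\<close> to a state represented by
  \<open>u'\<close>. Being a congruence by construction, it is a bisimulation.
\<close>

inductive mrel ::
    "('f, 'a) spec \<Rightarrow> ('f, 'v) trm \<Rightarrow> (('f, 'a) mop, 'v) trm \<Rightarrow> bool"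
  for S :: "('f, 'a) spec" where
  Tilde: "f \<in> Sig S \<Longrightarrow> length ts = arity S f \<Longrightarrow> list_all2 (mrel S) ts us
    \<Longrightarrow> mrel S (App f ts) (App (Tilde f) us)"
| Prefix: "s \<in> closed_terms S \<Longrightarrow> mrel S (snd (term_system S s)) u
    \<Longrightarrow> mrel S s (App (Prefix (fst (term_system S s))) [u])"

lemma step_term_system:
  assumes "stream_gsos S" and "t \<in> closed_terms S"
  shows "step S t (fst (term_system S t)) (snd (term_system S t))"
  unfolding term_system_def by (rule theI'[OF step_unique(1)[OF assms]])

lemma term_system_eqI:
  assumes "stream_gsos S" and "t \<in> closed_terms S" and "step S t a t'"
  shows "term_system S t = (a, t')"
  unfolding term_system_def
  by (rule the1_equality[OF step_unique(1)[OF assms(1,2)]]) (simp add: assms(3))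

text \<open>\<open>term_system\<close> is a definite description that determines a transition on
  closed terms only. In the \<open>Prefix\<close> case the stored output lies in
  \<open>Out S\<close>, so its prefix operation belongs to the monadic signature.\<close>

lemma mrel_closed:
  assumes S: "stream_gsos S" and "mrel S s u"
  shows "s \<in> closed_terms S" and "u \<in> closed_terms (monadic S)"
proof -
  have "s \<in> closed_terms S \<and> u \<in> closed_terms (monadic S)"
    using assms(2)
  proof induction
    case (Tilde f ts us)
    then show ?case
      by (auto simp: monadic_def list_all2_conv_all_nth in_set_conv_nth intro!: terms.App)
  next
    case (Prefix s u)
    then show ?case
      using step_unique(2)[OF S Prefix(1)] by (auto simp: monadic_def intro!: terms.App)
  qed
  then show "s \<in> closed_terms S" and "u \<in> closed_terms (monadic S)"
    by auto
qed

lemma mrel_tilde: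
  assumes "t \<in> closed_terms S"
  shows "mrel S t (tilde t)"
  using assms unfolding tilde_def
  by induction (auto simp: list_all2_conv_all_nth intro!: mrel.Tilde)

text \<open>The \<open>Tilde\<close> clause makes \<open>mrel\<close> a congruence. The two-stage
  substitution matches targets of monadic rules: \<open>\<rho>\<close> becomes
  \<open>prefix_sources as\<close>, and \<open>\<tau>\<close> the instantiation of the
  premises.\<close>

lemma mrel_subst:
  assumes "t \<in> terms (Sig S) (arity S) V"
    and "\<And>v. v \<in> V \<Longrightarrow> mrel S (\<sigma> v) (subst \<tau> (\<rho> v))"
  shows "mrel S (subst \<sigma> t) (subst \<tau> (subst \<rho> (tilde t)))"
  using assms(1) unfolding tilde_def
  by induction (auto simp: list_all2_conv_all_nth assms(2) intro!: mrel.Tilde)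

lemma mrel_step:
  assumes S: "stream_gsos S" and "mrel S s u"
  shows "\<exists>u'. step (monadic S) u (fst (term_system S s)) u' \<and> mrel S (snd (term_system S s)) u'"
  using assms(2)
proof induction
  case (Tilde f ts us)
  have closed: "\<forall>i<length ts. ts ! i \<in> closed_terms S" and len: "length us = length ts"
    using Tilde(3) by (auto simp: list_all2_conv_all_nth intro: mrel_closed(1)[OF S])
  have app: "App f ts \<in> closed_terms S"
    using Tilde(1,2) closed by (auto simp: in_set_conv_nth intro!: terms.App)
  from step_term_system[OF S app] show ?case
  proof cases
    case (1 as t ts')
    have comp: "term_system S (ts ! i) = (as ! i, ts' ! i)" if "i < length as" for i
      using that 1 closed by (intro term_system_eqI[OF S]) auto
    \<comment> \<open>\<open>Tilde(3)\<close> carries the induction hypothesis inside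
      \<open>list_all2\<close>, so it applies to each pair of arguments.\<close>
    have "\<forall>i<length as. \<exists>u'. step (monadic S) (us ! i) (as ! i) u' \<and> mrel S (ts' ! i) u'"
      using Tilde(3) comp \<open>length ts = length as\<close> by (auto simp: list_all2_conv_all_nth)
    then obtain g where g: "\<And>i. i < length as \<Longrightarrow>
        step (monadic S) (us ! i) (as ! i) (g i) \<and> mrel S (ts' ! i) (g i)"
      by metis
    define us' where "us' = map g [0..<length as]"
    let ?t = "subst (prefix_sources as) (tilde t)"
    let ?a = "fst (term_system S (App f ts))"
    have "Rule (Tilde f) as ?a ?t \<in> Rules (monadic S)"
      using 1 by (force simp: monadic_def image_iff)
    then have "step (monadic S) (App (Tilde f) us) ?a (subst (inst us us') ?t)"
      using 1 len g by (intro step.intros) (auto simp: us'_def)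
    moreover have "mrel S (subst (inst ts ts') t) (subst (inst us us') ?t)"
    proof (rule mrel_subst)
      show "t \<in> terms (Sig S) (arity S) (rule_vars (length as))"
        using S 1 Tilde(2) by (auto simp: stream_gsos_def wf_rule_def)
    next
      fix v assume "v \<in> rule_vars (length as)"
      then consider i where "v = Src i" "i < length as" | i where "v = Tgt i" "i < length as"
        by (auto simp: rule_vars_def)
      then show "mrel S (inst ts ts' v) (subst (inst us us') (prefix_sources as v))"
      proof cases
        case i: 1
        \<comment> \<open>Here the right-hand side is \<open>as ! i\<close> prefixed to the
          derivative \<open>g i\<close>; it represents \<open>ts ! i\<close> because
          \<open>g i\<close> represents \<open>ts' ! i\<close>.\<close>
        then show ?thesis
          using mrel.Prefix[of "ts ! i" S "g i"] closed comp g \<open>length ts = length as\<close>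
          by (simp add: us'_def)
      next
        case i: 2
        then show ?thesis
          using g by (simp add: us'_def)
      qed
    qed
    ultimately show ?thesis
      using 1 by auto
  qed
next
  case (Prefix s u)
  let ?a = "fst (term_system S s)" and ?s' = "snd (term_system S s)"
  \<comment> \<open>Prefixing acts as a one-place buffer: \<open>?a\<close> is emitted now, while
    \<open>?b\<close>, the current output of \<open>u\<close>, is stored for the next step.\<close>
  let ?b = "fst (term_system S ?s')"
  obtain u' where u': "step (monadic S) u ?b u'" "mrel S (snd (term_system S ?s')) u'"
    using Prefix.IH by blast
  have s': "?s' \<in> closed_terms S"
    by (rule step_unique(3)[OF S Prefix(1)])
  have "prefix_rule ?a ?b \<in> Rules (monadic S)"
    using step_unique(2)[OF S Prefix(1)] step_unique(2)[OF S s'] by (auto simp: monadic_def)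
  then have "step (monadic S) (App (Prefix ?a) [u]) ?a
      (subst (inst [u] [u']) (App (Prefix ?b) [Var (Tgt 0)]))"
    using u'(1) by (intro step.intros[where as = "[?b]"]) (auto simp: prefix_rule_def)
  then show ?case
    using mrel.Prefix[OF s' u'(2)] by auto
qed

text \<open>Bisimilarity is equality of generated streams here, so the bisimulation principle
  reduces to coinduction on streams.\<close>

lemma bisimilar_coinduct:
  assumes "R x y"
    and step: "\<And>x y. R x y \<Longrightarrow> fst (c x) = fst (d y) \<and> R (snd (c x)) (snd (d y))"
  shows "bisimilar c d x y"
  unfolding bisimilar_def generated_stream_def
  using assms(1)
proof (coinduction arbitrary: x y)
  case Eq_stream
  then show ?case using step by auto
qed

theorem theorem1:
  fixes S :: "('f, 'a) spec" and t :: "('f, 'v) trm"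
  assumes "stream_gsos S"
    and "t \<in> closed_terms S"
  shows "bisimilar (term_system S) (term_system (monadic S)) t (tilde t)"
proof (rule bisimilar_coinduct[where R = "mrel S"])
  show "mrel S t (tilde t)"
    by (rule mrel_tilde[OF assms(2)])
next
  fix s :: "('f, 'v) trm" and u
  assume su: "mrel S s u"
  obtain u' where u': "step (monadic S) u (fst (term_system S s)) u'"
      "mrel S (snd (term_system S s)) u'"
    using mrel_step[OF assms(1) su] by blast
  \<comment> \<open>Transitions of closed terms are unique in the monadic system too, so the one
    just found is the induced one.\<close>
  have "term_system (monadic S) u = (fst (term_system S s), u')"
    by (rule term_system_eqI[OF stream_gsos_monadic[OF assms(1)] mrel_closed(2)[OF assms(1) su] u'(1)])
  then show "fst (term_system S s) = fst (term_system (monadic S) u) \<and>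
      mrel S (snd (term_system S s)) (snd (term_system (monadic S) u))"
    using u'(2) by simp
qed

end
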